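(* Let $G$ be a group and let $x\in G$ have order $p^n$ for a prime $p$. Then $x$ cannot be a vertex with out-edges in a hole of even length in the power graph $\mathfrak{g}(G)$; that is, there is no hole of even length in $\mathfrak{g}(G)$ containing $x$ in which both neighbours of $x$ on the hole lie in $\langle x\rangle$.
   Context: The power graph $\mathfrak{g}(G)$ has vertex set $G$, distinct $x,y$ adjacent iff $\langle x\rangle\le\langle y\rangle$ or $\langle y\rangle\le\langle x\rangle$. A hole is a cycle in the graph such that no two of its vertices are joined by an edge not belonging to the cycle (a chordless/induced cycle). In the directed power graph an edge goes from $x$ to $y$ when $y\ne x$ and $\langle y\rangle\le\langle x\rangle$; a vertex "with out-edges" in a hole is one whose two hole-edges are both directed away from it, i.e. both its neighbours on the hole are powers of it. *)

theory Defs
  imports "HOL-Algebra.Multiplicative_Group" "HOL-Computational_Algebra.Primes"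
begin

text \<open>
  A simple graph on a (possibly infinite) vertex set is given by its set of edges, each edge being
  the two-element set of its end points.
\<close>

definition power_graph_edges :: "('a, 'b) monoid_scheme \<Rightarrow> 'a set set" where
  "power_graph_edges G =
    {{x, y} | x y. x \<in> carrier G \<and> y \<in> carrier G \<and> x \<noteq> y \<and>
      (generate G {x} \<subseteq> generate G {y} \<or> generate G {y} \<subseteq> generate G {x})}"

definition directed_power_graph_arcs :: "('a, 'b) monoid_scheme \<Rightarrow> ('a \<times> 'a) set" where
  "directed_power_graph_arcs G =
    {(x, y). x \<in> carrier G \<and> y \<in> carrier G \<and> y \<noteq> x \<and> generate G {y} \<subseteq> generate G {x}}"

text \<open>
  A cycle is represented by the list of its vertices in cyclic order, without repeating the first
  vertex at the end; the length of the list is the length of the cycle.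
\<close>

definition cycle_edges :: "'a list \<Rightarrow> 'a set set" where
  "cycle_edges c = {{c ! i, c ! (Suc i mod length c)} | i. i < length c}"

definition is_cycle :: "'a set \<Rightarrow> 'a set set \<Rightarrow> 'a list \<Rightarrow> bool" where
  "is_cycle V E c \<longleftrightarrow> 3 \<le> length c \<and> distinct c \<and> set c \<subseteq> V \<and> cycle_edges c \<subseteq> E"

text \<open>A triangle counts as a hole here, which is irrelevant for holes of even length.\<close>

definition is_hole :: "'a set \<Rightarrow> 'a set set \<Rightarrow> 'a list \<Rightarrow> bool" where
  "is_hole V E c \<longleftrightarrow> is_cycle V E c \<and>
    (\<forall>u \<in> set c. \<forall>v \<in> set c. {u, v} \<in> E \<longrightarrow> {u, v} \<in> cycle_edges c)"

definition vertex_with_out_edges :: "('a \<times> 'a) set \<Rightarrow> 'a list \<Rightarrow> 'a \<Rightarrow> bool" where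
  "vertex_with_out_edges A c x \<longleftrightarrow>
    x \<in> set c \<and> (\<forall>y. {x, y} \<in> cycle_edges c \<longrightarrow> (x, y) \<in> A)"

text \<open>
  In a cycle of the power graph, a vertex with out-edges is one whose neighbours on the cycle all
  lie in the cyclic subgroup it generates.
\<close>

lemma (in group) directed_power_graph_arcs_iff:
  assumes "x \<in> carrier G"
  shows "(x, y) \<in> directed_power_graph_arcs G \<longleftrightarrow> y \<noteq> x \<and> y \<in> generate G {x}"
proof -
  have sub: "subgroup (generate G {x}) G"
    using assms by (intro generate_is_subgroup) auto
  have "y \<in> generate G {y}"
    by (simp add: generate.incl)
  moreover have "generate G {y} \<subseteq> generate G {x}" if "y \<in> generate G {x}"
    using that sub by (intro generate_subgroup_incl) auto
  moreover have "y \<in> carrier G" if "y \<in> generate G {x}"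
    using that subgroup.subset[OF sub] by blast
  ultimately show ?thesis
    using assms unfolding directed_power_graph_arcs_def by blast
qed

end

theory Submission
  imports Defs
begin

text \<open>The subgroups of a cyclic group of prime power order form a chain. If both
  hole-neighbours of \<open>x\<close> lie in the subgroup generated by \<open>x\<close>, the
  subgroups they generate are therefore comparable, so the neighbours are adjacent in the power
  graph (\<open>generate_chain_prime_power\<close>). In a hole with at least four vertices such an
  edge would be a chord (\<open>hole_neighbours_nonadjacent\<close>). Even length rules out the
  triangle, the one case where the neighbours of a vertex are adjacent. The chain property rests on
  Bezout: the powers of \<open>x [^] a\<close> include every \<open>x [^] b\<close> with
  \<open>b\<close> a multiple of \<open>gcd a (int (ord x))\<close>.\<close>

lemma (in group) int_pow_in_generate_int_pow:
  fixes a b :: int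
  assumes x: "x \<in> carrier G" and dvd: "gcd a (int (ord x)) dvd b"
  shows "x [^] b \<in> generate G {x [^] a}"
proof -
  obtain u v where uv: "u * a + v * int (ord x) = gcd a (int (ord x))"
    using bezout_int by blast
  obtain m where m: "b = gcd a (int (ord x)) * m"
    using dvd by blast
  \<comment> \<open>This is the Bezout identity scaled by \<open>m\<close>; the multiple of
    \<open>ord x\<close> in the exponent contributes only a factor \<open>\<one>\<close>.\<close>
  have "b = a * (u * m) + int (ord x) * (v * m)"
    unfolding m uv[symmetric] by (simp add: algebra_simps)
  then have "x [^] b = (x [^] a) [^] (u * m) \<otimes> (x [^] int (ord x)) [^] (v * m)"
    using x by (simp add: int_pow_mult int_pow_pow)
  also have "\<dots> = (x [^] a) [^] (u * m)"
    using x by (simp add: int_pow_int)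
  finally show ?thesis
    using x by (auto simp: generate_pow)
qed

text \<open>Divisibility between the gcds of the exponents with \<open>ord x\<close> gives reversed
  inclusion between the generated subgroups. These gcds divide \<open>p ^ n\<close>, so they are
  powers of \<open>p\<close>, and divisibility is total on those.\<close>

lemma (in group) generate_chain_prime_power:
  assumes x: "x \<in> carrier G" and p: "prime p" and ord: "ord x = p ^ n"
    and y: "y \<in> generate G {x}" and z: "z \<in> generate G {x}"
  shows "generate G {y} \<subseteq> generate G {z} \<or> generate G {z} \<subseteq> generate G {y}"
proof -
  obtain a b :: int where ab: "y = x [^] a" "z = x [^] b"
    using x y z by (auto simp: generate_pow)
  have incl: "generate G {x [^] d} \<subseteq> generate G {x [^] c}"
    if "gcd c (int (ord x)) dvd gcd d (int (ord x))" for c d :: int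
  proof (rule generate_subgroup_incl)
    show "{x [^] d} \<subseteq> generate G {x [^] c}"
      using int_pow_in_generate_int_pow[OF x] that by auto
    show "subgroup (generate G {x [^] c}) G"
      using x by (intro generate_is_subgroup) auto
  qed
  \<comment> \<open>A divisor of a prime power is a prime power up to sign; a gcd is nonnegative, so
    \<open>normalize\<close> leaves it unchanged.\<close>
  have pow: "\<exists>i. gcd c (int (ord x)) = int p ^ i" for c :: int
  proof -
    have "prime (int p)"
      using p by simp
    moreover have "gcd c (int (ord x)) dvd int p ^ n"
      by (metis gcd_dvd2 of_nat_power ord)
    ultimately obtain i where "normalize (gcd c (int (ord x))) = int p ^ i"
      by (rule divides_primepow)
    then show ?thesis by auto
  qed
  obtain i j where "gcd a (int (ord x)) = int p ^ i" "gcd b (int (ord x)) = int p ^ j"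
    using pow by meson
  then have "gcd a (int (ord x)) dvd gcd b (int (ord x)) \<or> gcd b (int (ord x)) dvd gcd a (int (ord x))"
    using linear[of i j] by (metis le_imp_power_dvd)
  then show ?thesis
    using incl ab by blast
qed

text \<open>The witnesses are the successor and the predecessor of \<open>x\<close> on the cycle.
  Their positions differ by two, so with at least four vertices they are not consecutive, and an
  edge between them would be a chord.\<close>

lemma hole_neighbours_nonadjacent:
  assumes hole: "is_hole V E c" and len: "4 \<le> length c" and x: "x \<in> set c"
  obtains y z where "{x, y} \<in> cycle_edges c" "{x, z} \<in> cycle_edges c" "y \<noteq> z"
    "{y, z} \<notin> E"
proof -
  define k where "k = length c"
  have k: "4 \<le> k" using len by (simp add: k_def)
  have dist: "distinct c"
    using hole by (simp add: is_hole_def is_cycle_def)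
  obtain i where i: "i < k" "x = c ! i"
    using x by (auto simp: in_set_conv_nth k_def)
  define s where "s = Suc i mod k"
  define r where "r = (if i = 0 then k - 1 else i - 1)"
  \<comment> \<open>Writing the wrap-around as a case distinction removes \<open>mod\<close> and
    leaves linear arithmetic.\<close>
  have s: "s = (if i = k - 1 then 0 else Suc i)"
    using i k by (auto simp: s_def)
  have sr: "s < k" "r < k" "s \<noteq> r" "Suc r mod k = i"
    using i k by (auto simp: s r_def)
  have eq: "c ! a = c ! b \<longleftrightarrow> a = b" if "a < k" "b < k" for a b
    using that dist by (simp add: nth_eq_iff_index_eq k_def)
  have "{x, c ! s} \<in> cycle_edges c"
    using i by (auto simp: cycle_edges_def s_def k_def)
  moreover have "{x, c ! r} \<in> cycle_edges c"
    using i sr by (auto simp: cycle_edges_def k_def insert_commute intro!: exI[of _ r])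
  moreover have "c ! s \<noteq> c ! r"
    using eq sr by blast
  moreover have "{c ! s, c ! r} \<notin> E"
  proof
    assume "{c ! s, c ! r} \<in> E"
    then have "{c ! s, c ! r} \<in> cycle_edges c"
      using hole sr by (auto simp: is_hole_def k_def)
    then obtain j where j: "j < k" "{c ! s, c ! r} = {c ! j, c ! (Suc j mod k)}"
      by (auto simp: cycle_edges_def k_def)
    have "Suc j mod k < k" using k by simp
    \<comment> \<open>Distinctness turns equality of edges into equality of positions. Since
      \<open>s\<close> is \<open>r + 2\<close> modulo \<open>k\<close>, the two cases would force
      \<open>k\<close> to divide 3 or 1, against \<open>4 \<le> k\<close>.\<close>
    then have "s = j \<and> r = Suc j mod k \<or> s = Suc j mod k \<and> r = j"
      using j sr by (simp add: doubleton_eq_iff eq)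
    moreover have "Suc j mod k = (if j = k - 1 then 0 else Suc j)"
      using j k by auto
    ultimately show False
      using i k by (auto simp: s r_def split: if_splits)
  qed
  ultimately show ?thesis by (rule that)
qed

theorem theorem4:
  fixes G :: "('a, 'b) monoid_scheme" and x :: 'a and p n :: nat
  assumes "group G"
    and "x \<in> carrier G"
    and "prime p"
    and "group.ord G x = p ^ n"
  shows "\<not> (\<exists>c. is_hole (carrier G) (power_graph_edges G) c \<and> even (length c) \<and>
    vertex_with_out_edges (directed_power_graph_arcs G) c x)"
proof
  interpret group G by fact
  assume "\<exists>c. is_hole (carrier G) (power_graph_edges G) c \<and> even (length c) \<and>
    vertex_with_out_edges (directed_power_graph_arcs G) c x"
  then obtain c where c: "is_hole (carrier G) (power_graph_edges G) c" "even (length c)"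
    and out: "x \<in> set c" "\<And>y. {x, y} \<in> cycle_edges c \<Longrightarrow> (x, y) \<in> directed_power_graph_arcs G"
    by (auto simp: vertex_with_out_edges_def)
  have "3 \<le> length c"
    using c by (simp add: is_hole_def is_cycle_def)
  \<comment> \<open>Parity is used only here: a triangle satisfies \<open>is_hole\<close> vacuously,
    having no chords.\<close>
  moreover have "length c \<noteq> 3"
    using c by auto
  ultimately have "4 \<le> length c" by simp
  then obtain y z where "{x, y} \<in> cycle_edges c" "{x, z} \<in> cycle_edges c" "y \<noteq> z"
    and nonadj: "{y, z} \<notin> power_graph_edges G"
    using hole_neighbours_nonadjacent c out by metis
  then have "(x, y) \<in> directed_power_graph_arcs G" "(x, z) \<in> directed_power_graph_arcs G"
    using out by auto
  then have "y \<in> carrier G" "z \<in> carrier G" "y \<in> generate G {x}" "z \<in> generate G {x}"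
    using directed_power_graph_arcs_iff[OF assms(2)] by (auto simp: directed_power_graph_arcs_def)
  moreover from this have "generate G {y} \<subseteq> generate G {z} \<or> generate G {z} \<subseteq> generate G {y}"
    using generate_chain_prime_power assms by blast
  ultimately show False
    using nonadj \<open>y \<noteq> z\<close> by (auto simp: power_graph_edges_def)
qed

end
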